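(* For integers $s\ge 3$ and $t\ge s+2$ with $(s,t)\notin\{(3,5),(3,7)\}$, we have $$r\!\left(K_{n,n},K_{s,t},\,st-\left\lfloor\tfrac{s+t}{2}\right\rfloor+1\right)=\Omega(n^{4/3}).$$
   Context: For graphs $G,H$ and an integer $q$ with $2\le q\le |E(H)|$, an $(H,q)$-coloring of $G$ is an edge-coloring of $G$ in which every subgraph of $G$ isomorphic to $H$ receives at least $q$ distinct colors; $r(G,H,q)$ is the minimum number of colors needed for $G$ to have an $(H,q)$-coloring. $K_{n,n}$, $K_{s,t}$ denote complete bipartite graphs. Asymptotic notation refers to $n\to\infty$ with $s,t$ fixed. *)

theory Defs
  imports Complex_Main "HOL-Library.Landau_Symbols"
begin

record 'a ugraph =
  uverts :: "'a set"
  uedges :: "'a set set"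

definition simple_graph :: "'a ugraph \<Rightarrow> bool" where
  "simple_graph G \<longleftrightarrow> finite (uverts G) \<and> (\<forall>e\<in>uedges G. e \<subseteq> uverts G \<and> card e = 2)"

definition is_subgraph :: "'a ugraph \<Rightarrow> 'a ugraph \<Rightarrow> bool" where
  "is_subgraph F G \<longleftrightarrow> simple_graph F \<and> uverts F \<subseteq> uverts G \<and> uedges F \<subseteq> uedges G"

definition graph_iso :: "'a ugraph \<Rightarrow> 'b ugraph \<Rightarrow> bool" where
  "graph_iso F H \<longleftrightarrow>
     (\<exists>f. bij_betw f (uverts F) (uverts H) \<and>
          (\<forall>u\<in>uverts F. \<forall>v\<in>uverts F. {u, v} \<in> uedges F \<longleftrightarrow> {f u, f v} \<in> uedges H))"

definition complete_bipartite :: "nat \<Rightarrow> nat \<Rightarrow> (nat + nat) ugraph" where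
  "complete_bipartite m n =
     \<lparr>uverts = {..<m} <+> {..<n}, uedges = {{Inl i, Inr j} | i j. i < m \<and> j < n}\<rparr>"

text \<open>Subgraphs need not be induced, and colorings need not be proper. Only the
  values of \<open>c\<close> on the edges of \<open>G\<close> matter.\<close>

definition Hq_coloring :: "'b ugraph \<Rightarrow> nat \<Rightarrow> 'a ugraph \<Rightarrow> ('a set \<Rightarrow> nat) \<Rightarrow> bool" where
  "Hq_coloring H q G c \<longleftrightarrow>
     (\<forall>F. is_subgraph F G \<and> graph_iso F H \<longrightarrow> q \<le> card (c ` uedges F))"

text \<open>The number \<open>r(G, H, q)\<close>. It is meant for \<open>2 \<le> q \<le> |E(H)|\<close>; a suitable
  number of colors then always exists, see \<open>Hq_coloring_exists\<close> below.\<close>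

definition gen_ramsey :: "'a ugraph \<Rightarrow> 'b ugraph \<Rightarrow> nat \<Rightarrow> nat" where
  "gen_ramsey G H q =
     (LEAST k. \<exists>c. c ` uedges G \<subseteq> {..<k} \<and> Hq_coloring H q G c)"

lemma simple_graph_finite_edges: "simple_graph G \<Longrightarrow> finite (uedges G)"
  unfolding simple_graph_def by (rule finite_subset[of _ "Pow (uverts G)"]) auto

lemma graph_iso_card_edges:
  assumes F: "simple_graph F" and H: "simple_graph H" and "graph_iso F H"
  shows "card (uedges F) = card (uedges H)"
proof -
  obtain f where f: "bij_betw f (uverts F) (uverts H)"
    and e: "\<And>u v. u \<in> uverts F \<Longrightarrow> v \<in> uverts F \<Longrightarrow> {u, v} \<in> uedges F \<longleftrightarrow> {f u, f v} \<in> uedges H"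
    using assms(3) unfolding graph_iso_def by blast
  have inj: "inj_on ((`) f) (uedges F)"
    using f F unfolding bij_betw_def simple_graph_def
    by (meson inj_onI inj_on_image_eq_iff)
  have "(`) f ` uedges F = uedges H"
  proof (intro equalityI subsetI)
    fix x assume "x \<in> (`) f ` uedges F"
    then obtain d where d: "d \<in> uedges F" "x = f ` d" by auto
    then obtain u v where "d = {u, v}" "u \<in> uverts F" "v \<in> uverts F"
      using F unfolding simple_graph_def card_2_iff by fastforce
    then show "x \<in> uedges H" using e d by auto
  next
    fix x assume x: "x \<in> uedges H"
    then obtain a b where ab: "x = {a, b}" "a \<in> uverts H" "b \<in> uverts H"
      using H unfolding simple_graph_def card_2_iff by fastforce
    then obtain u v where uv: "u \<in> uverts F" "v \<in> uverts F" "a = f u" "b = f v"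
      using f unfolding bij_betw_def by (metis imageE)
    then have "{u, v} \<in> uedges F" using e x ab by auto
    then show "x \<in> (`) f ` uedges F" using ab uv by (intro image_eqI[of _ _ "{u, v}"]) auto
  qed
  with inj show ?thesis by (metis card_image)
qed

lemma Hq_coloring_exists:
  assumes "simple_graph G" "simple_graph H" "q \<le> card (uedges H)"
  shows "\<exists>k c. c ` uedges G \<subseteq> {..<k} \<and> Hq_coloring H q G c"
proof -
  obtain c :: "'a set \<Rightarrow> nat" and k where c: "c ` uedges G = {i. i < k}" "inj_on c (uedges G)"
    using finite_imp_inj_to_nat_seg[OF simple_graph_finite_edges[OF assms(1)]] by metis
  have "q \<le> card (c ` uedges F)" if "is_subgraph F G" "graph_iso F H" for F
  proof -
    have "card (c ` uedges F) = card (uedges F)"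
      using that c(2) unfolding is_subgraph_def by (metis card_image inj_on_subset)
    then show ?thesis
      using graph_iso_card_edges[of F H] that assms unfolding is_subgraph_def by simp
  qed
  then show ?thesis using c(1) unfolding Hq_coloring_def
    by (intro exI[of _ k] exI[of _ c]) auto
qed

lemma simple_graph_complete_bipartite: "simple_graph (complete_bipartite m n)"
  unfolding simple_graph_def complete_bipartite_def by auto

lemma card_edges_complete_bipartite: "card (uedges (complete_bipartite m n)) = m * n"
proof -
  have "uedges (complete_bipartite m n) = (\<lambda>(i, j). {Inl i, Inr j}) ` ({..<m} \<times> {..<n})"
    unfolding complete_bipartite_def by auto
  moreover have "inj_on (\<lambda>(i, j). {Inl i, Inr j} :: (nat + nat) set) ({..<m} \<times> {..<n})"
    by (auto simp: inj_on_def doubleton_eq_iff)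
  ultimately show ?thesis by (simp add: card_image)
qed

end

(* A copy of K_{s,t} violates the condition as soon as it has at most s t - m colors, where
   m = (s + t) div 2; so it suffices to find, in either orientation, m repetitions of colors among
   the edges on such a vertex set.
   A monochromatic star with t leaves already does this because t >= s + 2, so every color A has
   bounded degree and touches sets X_A, Y_A of size comparable to its number of edges; on average
   this is n^2/k, where k is the number of colors.
   If t <= s + 4, the rectangles X_A x Y_A have total area at least about k (n^2/k)^2. If k is much
   smaller than n^(4/3), this exceeds k^2 by a large factor, so some rectangle contains many edges
   of a single other color B, and A together with B gives the repeats.
   If t >= s + 5, the sum of |X_A|^3 is about k (n^2/k)^3, which exceeds n^3 by a large factor, so
   some three vertices see many common colors. Joining these incidences with s edges of one of these
   colors gives the repeats. *)

theory Submission
  imports Defs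
begin

section \<open>Copies of K_{s,t} in K_{n,n} and their repeated colors\<close>

lemma doubleton_mem_product_iff:
  "{u, v} \<in> {{p, q} | p q. p \<in> P \<and> q \<in> Q} \<longleftrightarrow> u \<in> P \<and> v \<in> Q \<or> v \<in> P \<and> u \<in> Q"
  by (auto simp: doubleton_eq_iff)

text \<open>The maps \<open>a\<close> and \<open>b\<close> name the two sides, so
  \<open>Inl\<close>, \<open>Inr\<close> and \<open>Inr\<close>, \<open>Inl\<close> cover both
  orientations of K_{s,t}. One common left inverse \<open>a'\<close> makes both maps injective and
  their ranges disjoint.\<close>

lemma Hq_coloring_embedding:
  fixes a b :: "nat \<Rightarrow> nat + nat"
  assumes col: "Hq_coloring (complete_bipartite s t) q (complete_bipartite n n) c"
    and S: "finite S" "card S = s" and T: "finite T" "card T = t"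
    and V: "a ` S \<union> b ` T \<subseteq> uverts (complete_bipartite n n)"
    and E: "\<And>x y. x \<in> S \<Longrightarrow> y \<in> T \<Longrightarrow> {a x, b y} \<in> uedges (complete_bipartite n n)"
    and inv: "\<And>x. a' (a x) = Inl x" "\<And>y. a' (b y) = Inr y"
  shows "q \<le> card ((\<lambda>(x, y). c {a x, b y}) ` (S \<times> T))"
proof -
  obtain g where g: "bij_betw g S {..<s}"
    using S ex_bij_betw_finite_nat[of S] by (auto simp: atLeast0LessThan)
  obtain h where h: "bij_betw h T {..<t}"
    using T ex_bij_betw_finite_nat[of T] by (auto simp: atLeast0LessThan)
  define \<phi> where "\<phi> = map_sum g h \<circ> a'"
  have \<phi>: "\<phi> (a x) = Inl (g x)" "\<phi> (b y) = Inr (h y)" for x y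
    by (simp_all add: \<phi>_def inv)
  define F where "F = \<lparr>uverts = a ` S \<union> b ` T, uedges = (\<lambda>(x, y). {a x, b y}) ` (S \<times> T)\<rparr>"
  have ab: "a x \<noteq> b y" "a x = a x' \<longleftrightarrow> x = x'" "b y = b y' \<longleftrightarrow> y = y'" for x y x' y'
    using inv by (metis sum.distinct(1), metis sum.inject(1), metis sum.inject(2))
  have "is_subgraph F (complete_bipartite n n)"
    using V E S T ab unfolding is_subgraph_def simple_graph_def F_def by auto
  moreover have "graph_iso F (complete_bipartite s t)"
    unfolding graph_iso_def
  proof (intro exI[of _ \<phi>] conjI ballI)
    have gh: "g x = g x' \<longleftrightarrow> x = x'" if "x \<in> S" "x' \<in> S" for x x'
      using g that by (auto simp: bij_betw_def inj_on_def)
    have hh: "h x = h x' \<longleftrightarrow> x = x'" if "x \<in> T" "x' \<in> T" for x x'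
      using h that by (auto simp: bij_betw_def inj_on_def)
    have im: "g ` S = {..<s}" "h ` T = {..<t}"
      using g h by (auto simp: bij_betw_def)
    have "\<phi> ` (a ` S \<union> b ` T) = {..<s} <+> {..<t}"
      unfolding image_Un image_image \<phi> Plus_def im[symmetric] by auto
    moreover have "inj_on \<phi> (a ` S \<union> b ` T)"
    proof (rule inj_onI)
      fix u v assume "u \<in> a ` S \<union> b ` T" "v \<in> a ` S \<union> b ` T" "\<phi> u = \<phi> v"
      then show "u = v" by (elim UnE imageE) (simp_all add: \<phi> gh hh)
    qed
    ultimately show "bij_betw \<phi> (uverts F) (uverts (complete_bipartite s t))"
      by (simp add: bij_betw_def F_def complete_bipartite_def)
    fix u v assume uv: "u \<in> uverts F" "v \<in> uverts F"
    have gS: "g x < s" if "x \<in> S" for x using imageI[OF that, of g] unfolding im by simp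
    have hT: "h y < t" if "y \<in> T" for y using imageI[OF that, of h] unfolding im by simp
    have L: "\<phi> w \<in> Inl ` {..<s} \<longleftrightarrow> w \<in> a ` S" and R: "\<phi> w \<in> Inr ` {..<t} \<longleftrightarrow> w \<in> b ` T"
      if "w \<in> uverts F" for w
      using that ab ab(1)[symmetric] by (auto simp: F_def \<phi> gS hT)
    have K: "uedges (complete_bipartite s t) = {{p, q} | p q. p \<in> Inl ` {..<s} \<and> q \<in> Inr ` {..<t}}"
      unfolding complete_bipartite_def by auto
    have "{u, v} \<in> uedges F \<longleftrightarrow> u \<in> a ` S \<and> v \<in> b ` T \<or> v \<in> a ` S \<and> u \<in> b ` T"
      unfolding doubleton_mem_product_iff[symmetric] F_def by auto
    also have "\<dots> \<longleftrightarrow> \<phi> u \<in> Inl ` {..<s} \<and> \<phi> v \<in> Inr ` {..<t}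
        \<or> \<phi> v \<in> Inl ` {..<s} \<and> \<phi> u \<in> Inr ` {..<t}"
      using uv L R by simp
    also have "\<dots> \<longleftrightarrow> {\<phi> u, \<phi> v} \<in> uedges (complete_bipartite s t)"
      unfolding K doubleton_mem_product_iff ..
    finally show "({u, v} \<in> uedges F) = ({\<phi> u, \<phi> v} \<in> uedges (complete_bipartite s t))" .
  qed
  ultimately have "q \<le> card (c ` uedges F)"
    using col unfolding Hq_coloring_def by blast
  then show ?thesis by (simp add: F_def image_image case_prod_unfold)
qed

text \<open>Pad the endpoints of \<open>E0\<close> to vertex sets of sizes \<open>s\<close> and
  \<open>t\<close>. Each of the s t - |E0| further edges adds at most one color, so \<open>m\<close>
  repetitions inside \<open>E0\<close> would leave at most s t - m colors on the copy.\<close>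

lemma card_edges_less_colors:
  fixes a b :: "nat \<Rightarrow> nat + nat"
  defines "f \<equiv> \<lambda>c (x, y). c {a x, b y}"
  assumes col: "Hq_coloring (complete_bipartite s t) (s * t - m + 1) (complete_bipartite n n) c"
    and V: "a ` {..<n} \<union> b ` {..<n} \<subseteq> uverts (complete_bipartite n n)"
    and E: "\<And>x y. x < n \<Longrightarrow> y < n \<Longrightarrow> {a x, b y} \<in> uedges (complete_bipartite n n)"
    and inv: "\<And>x. a' (a x) = Inl x" "\<And>y. a' (b y) = Inr y"
    and m: "m \<le> s * t" and n: "s \<le> n" "t \<le> n"
    and E0: "E0 \<subseteq> {..<n} \<times> {..<n}" "card (fst ` E0) \<le> s" "card (snd ` E0) \<le> t"
  shows "card E0 < card (f c ` E0) + m"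
proof -
  have fin: "finite E0" using E0(1) by (rule finite_subset) simp
  have "fst ` E0 \<subseteq> {..<n}" "snd ` E0 \<subseteq> {..<n}" using E0(1) by auto
  then obtain S T where S: "fst ` E0 \<subseteq> S" "S \<subseteq> {..<n}" "card S = s"
    and T: "snd ` E0 \<subseteq> T" "T \<subseteq> {..<n}" "card T = t"
    using exists_subset_between[of "fst ` E0" s "{..<n}"]
      exists_subset_between[of "snd ` E0" t "{..<n}"] E0 n by auto
  have finST: "finite S" "finite T" using S(2) T(2) by (auto intro: finite_subset)
  have sub: "E0 \<subseteq> S \<times> T" using S T by force
  have "s * t - m + 1 \<le> card (f c ` (S \<times> T))"
    unfolding f_def
    by (rule Hq_coloring_embedding[OF col, where a = a and b = b and a' = a' and S = S and T = T])
      (use finST S T V E inv in \<open>auto simp: subset_iff\<close>)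
  also have "f c ` (S \<times> T) = f c ` E0 \<union> f c ` (S \<times> T - E0)" using sub by auto
  also have "card \<dots> \<le> card (f c ` E0) + card (f c ` (S \<times> T - E0))" by (rule card_Un_le)
  also have "\<dots> \<le> card (f c ` E0) + card (S \<times> T - E0)"
    using finST by (intro add_left_mono card_image_le) auto
  also have "card (S \<times> T - E0) = s * t - card E0"
    using sub fin S T by (simp add: card_Diff_subset card_cartesian_product)
  finally have "s * t - m + 1 \<le> card (f c ` E0) + (s * t - card E0)" .
  moreover have "card E0 \<le> s * t"
    using card_mono[OF _ sub] finST S T by (simp add: card_cartesian_product)
  ultimately show ?thesis using m by linarith
qed

section \<open>Power means and a cubic bound for binomial coefficients\<close>

lemma sum_power2_le:
  fixes e :: "nat \<Rightarrow> nat"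
  shows "(\<Sum>i<k. e i)\<^sup>2 \<le> k * (\<Sum>i<k. (e i)\<^sup>2)"
proof (cases "k = 0")
  case False
  define \<sigma> where "\<sigma> = (\<Sum>i<k. real (e i))"
  have "2 * \<sigma> * (k * e i) - \<sigma>\<^sup>2 \<le> (real k)\<^sup>2 * (e i)\<^sup>2" for i
    using zero_le_power2[of "real k * e i - \<sigma>"] by (simp add: power2_eq_square algebra_simps)
  then have "(\<Sum>i<k. 2 * \<sigma> * (k * e i) - \<sigma>\<^sup>2) \<le> (\<Sum>i<k. (real k)\<^sup>2 * (e i)\<^sup>2)"
    by (rule sum_mono)
  moreover have "(\<Sum>i<k. 2 * \<sigma> * (k * e i) - \<sigma>\<^sup>2) = 2 * \<sigma> * (k * \<sigma>) - k * \<sigma>\<^sup>2"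
    unfolding sum_subtractf \<sigma>_def by (simp add: sum_distrib_left)
  ultimately have "real k * \<sigma>\<^sup>2 \<le> real k * (real k * (\<Sum>i<k. (e i)\<^sup>2))"
    by (simp add: power2_eq_square algebra_simps flip: sum_distrib_left)
  then have "\<sigma>\<^sup>2 \<le> real k * (\<Sum>i<k. (e i)\<^sup>2)" using False by simp
  then have "real ((\<Sum>i<k. e i)\<^sup>2) \<le> real (k * (\<Sum>i<k. (e i)\<^sup>2))" by (simp add: \<sigma>_def)
  then show ?thesis by (simp only: of_nat_le_iff)
qed simp

text \<open>Power mean inequality from a tangent to the cube: x^3 - 3 \<sigma>^2 x + 2 \<sigma>^3 =
  (x - \<sigma>)^2 (x + 2 \<sigma>) with x = k e_i, summed over i.\<close>

lemma sum_power3_le: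
  fixes e :: "nat \<Rightarrow> nat"
  shows "(\<Sum>i<k. e i) ^ 3 \<le> k\<^sup>2 * (\<Sum>i<k. e i ^ 3)"
proof (cases "k = 0")
  case False
  define \<sigma> where "\<sigma> = (\<Sum>i<k. real (e i))"
  have \<sigma>: "0 \<le> \<sigma>" by (auto simp: \<sigma>_def intro: sum_nonneg)
  have "3 * \<sigma>\<^sup>2 * (k * e i) - 2 * \<sigma> ^ 3 \<le> real k ^ 3 * e i ^ 3" for i
  proof -
    have "0 \<le> (real k * e i - \<sigma>)\<^sup>2 * (real k * e i + 2 * \<sigma>)"
      using \<sigma> by (intro mult_nonneg_nonneg) auto
    then show ?thesis by (simp add: power2_eq_square power3_eq_cube algebra_simps)
  qed
  then have "(\<Sum>i<k. 3 * \<sigma>\<^sup>2 * (k * e i) - 2 * \<sigma> ^ 3) \<le> (\<Sum>i<k. real k ^ 3 * e i ^ 3)"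
    by (rule sum_mono)
  moreover have "(\<Sum>i<k. 3 * \<sigma>\<^sup>2 * (k * e i) - 2 * \<sigma> ^ 3) = 3 * \<sigma>\<^sup>2 * (k * \<sigma>) - k * (2 * \<sigma> ^ 3)"
    unfolding sum_subtractf \<sigma>_def by (simp add: sum_distrib_left)
  ultimately have "real k * \<sigma> ^ 3 \<le> real k * (real k ^ 2 * (\<Sum>i<k. e i ^ 3))"
    by (simp add: power2_eq_square power3_eq_cube algebra_simps flip: sum_distrib_left)
  then have "\<sigma> ^ 3 \<le> real k ^ 2 * (\<Sum>i<k. e i ^ 3)" using False by simp
  then have "real ((\<Sum>i<k. e i) ^ 3) \<le> real (k\<^sup>2 * (\<Sum>i<k. e i ^ 3))" by (simp add: \<sigma>_def)
  then show ?thesis by (simp only: of_nat_le_iff)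
qed simp

text \<open>The constant gives equality at a = 3; Pascal's rule then reduces the induction step to
  comparing (a + 1)^3 - a^3 with 27 (a choose 2).\<close>

lemma power3_le_choose:
  assumes "3 \<le> a"
  shows "a ^ 3 \<le> 27 * (a choose 3)"
  using assms
proof (induction a rule: nat_induct_at_least)
  case base
  show ?case by simp
next
  case (Suc a)
  obtain b where b: "a = Suc b" "2 \<le> b" using Suc.hyps by (cases a) auto
  have c2: "2 * (a choose 2) = a * b" using b by (simp add: choose_two)
  have "Suc a choose 3 = (a choose 3) + (a choose 2)" by (simp add: numeral_eq_Suc)
  then have "2 * (27 * (Suc a choose 3)) = 2 * (27 * (a choose 3)) + 27 * (a * b)" using c2 by linarith
  moreover have "2 * (Suc a ^ 3) \<le> 2 * a ^ 3 + 27 * (a * b)"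
  proof -
    have "2 * b \<le> b * b" using b by simp
    with b(2) show ?thesis by (simp add: b(1) power3_eq_cube algebra_simps)
  qed
  ultimately show ?case using Suc.IH by linarith
qed

section \<open>Colorings with few repeats and their color classes\<close>

text \<open>Here \<open>f (x, y)\<close> is the color of the edge from left vertex \<open>x\<close>
  to right vertex \<open>y\<close>. The part of size \<open>s\<close> lies on the left in
  \<open>few_repeats\<close> and on the right in \<open>few_repeats'\<close>.\<close>

locale repeat_free =
  fixes f :: "nat \<times> nat \<Rightarrow> nat" and n k s t m :: nat
  assumes colors: "x < n \<Longrightarrow> y < n \<Longrightarrow> f (x, y) < k"
    and st: "3 \<le> s" "s + 2 \<le> t"
    and m_def: "m = (s + t) div 2"
    and few_repeats: "E \<subseteq> {..<n} \<times> {..<n} \<Longrightarrow> card (fst ` E) \<le> s \<Longrightarrow> card (snd ` E) \<le> t \<Longrightarrow>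
           card E < card (f ` E) + m"
    and few_repeats': "E \<subseteq> {..<n} \<times> {..<n} \<Longrightarrow> card (fst ` E) \<le> t \<Longrightarrow> card (snd ` E) \<le> s \<Longrightarrow>
           card E < card (f ` E) + m"
begin

definition edges :: "nat \<Rightarrow> (nat \<times> nat) set" where
  "edges A = {p \<in> {..<n} \<times> {..<n}. f p = A}"

abbreviation X :: "nat \<Rightarrow> nat set" where "X A \<equiv> fst ` edges A"
abbreviation Y :: "nat \<Rightarrow> nat set" where "Y A \<equiv> snd ` edges A"

lemma finite_edges [simp]: "finite (edges A)"
  unfolding edges_def by (rule finite_subset[of _ "{..<n} \<times> {..<n}"]) auto

lemma edgesD: "(x, y) \<in> edges A \<Longrightarrow> x < n \<and> y < n \<and> f (x, y) = A"
  by (auto simp: edges_def)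

lemma XE:
  assumes "x \<in> X A" obtains y where "(x, y) \<in> edges A"
  using assms by force

text \<open>A monochromatic star with \<open>t\<close> edges has t - 1 repetitions, and t - 1 \<ge>
  m because t \<ge> s + 2.\<close>

lemma star_bound:
  assumes "E \<subseteq> edges A" "card (fst ` E) \<le> 1"
  shows "card E < t"
proof (rule ccontr)
  assume "\<not> card E < t"
  then obtain E' where E': "E' \<subseteq> E" "card E' = t"
    by (meson not_less obtain_subset_with_card_n)
  have fin: "finite E" using assms(1) by (rule finite_subset) simp
  have finE': "finite E'" using E'(1) fin by (rule finite_subset)
  have "card (fst ` E') \<le> card (fst ` E)" using E' fin by (intro card_mono) auto
  moreover have "card (snd ` E') \<le> t" using E' card_image_le[OF finE', of snd] by simp
  moreover have "E' \<subseteq> {..<n} \<times> {..<n}" using E' assms by (auto simp: edges_def)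
  ultimately have "card E' < card (f ` E') + m" using few_repeats st assms by auto
  moreover have "card (f ` E') \<le> card {A}"
    using E' assms by (intro card_mono) (auto simp: edges_def)
  ultimately show False using E' st m_def by simp
qed

lemma star_bound':
  assumes "E \<subseteq> edges A" "card (snd ` E) \<le> 1"
  shows "card E < t"
proof (rule ccontr)
  assume "\<not> card E < t"
  then obtain E' where E': "E' \<subseteq> E" "card E' = t"
    by (meson not_less obtain_subset_with_card_n)
  have fin: "finite E" using assms(1) by (rule finite_subset) simp
  have finE': "finite E'" using E'(1) fin by (rule finite_subset)
  have "card (snd ` E') \<le> card (snd ` E)" using E' fin by (intro card_mono) auto
  moreover have "card (fst ` E') \<le> t" using E' card_image_le[OF finE', of fst] by simp
  moreover have "E' \<subseteq> {..<n} \<times> {..<n}" using E' assms by (auto simp: edges_def)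
  ultimately have "card E' < card (f ` E') + m" using few_repeats' st assms by auto
  moreover have "card (f ` E') \<le> card {A}"
    using E' assms by (intro card_mono) (auto simp: edges_def)
  ultimately show False using E' st m_def by simp
qed

lemma card_le_fst:
  assumes "E \<subseteq> edges A"
  shows "card E \<le> t * card (fst ` E)"
proof -
  have fin: "finite E" using assms by (rule finite_subset) simp
  have "(\<Union>x\<in>fst ` E. {p \<in> E. fst p = x}) = E" by auto
  then have "card E \<le> (\<Sum>x\<in>fst ` E. card {p \<in> E. fst p = x})"
    using fin card_UN_le[of "fst ` E" "\<lambda>x. {p \<in> E. fst p = x}"] by simp
  also have "\<dots> \<le> (\<Sum>x\<in>fst ` E. t)"
  proof (rule sum_mono)
    fix x
    have "fst ` {p \<in> E. fst p = x} \<subseteq> {x}" by auto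
    from card_mono[OF _ this] show "card {p \<in> E. fst p = x} \<le> t"
      using star_bound[of "{p \<in> E. fst p = x}" A] assms by fastforce
  qed
  finally show ?thesis by (simp add: mult.commute)
qed

lemma card_le_snd:
  assumes "E \<subseteq> edges A"
  shows "card E \<le> t * card (snd ` E)"
proof -
  have fin: "finite E" using assms by (rule finite_subset) simp
  have "(\<Union>x\<in>snd ` E. {p \<in> E. snd p = x}) = E" by auto
  then have "card E \<le> (\<Sum>x\<in>snd ` E. card {p \<in> E. snd p = x})"
    using fin card_UN_le[of "snd ` E" "\<lambda>x. {p \<in> E. snd p = x}"] by simp
  also have "\<dots> \<le> (\<Sum>x\<in>snd ` E. t)"
  proof (rule sum_mono)
    fix x
    have "snd ` {p \<in> E. snd p = x} \<subseteq> {x}" by auto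
    from card_mono[OF _ this] show "card {p \<in> E. snd p = x} \<le> t"
      using star_bound'[of "{p \<in> E. snd p = x}" A] assms by fastforce
  qed
  finally show ?thesis by (simp add: mult.commute)
qed

lemma sum_card_edges: "(\<Sum>A<k. card (edges A)) = n\<^sup>2"
proof -
  have "(\<Sum>A<k. card (edges A)) = card (\<Union>A<k. edges A)"
    by (rule card_UN_disjoint[symmetric]) (auto simp: edges_def)
  also have "(\<Union>A<k. edges A) = {..<n} \<times> {..<n}"
    using colors by (auto simp: edges_def)
  finally show ?thesis by (simp add: card_cartesian_product power2_eq_square)
qed

section \<open>Repeats counted on incidences of vertices and colors\<close>

text \<open>Edges chosen for different pairs (vertex, color) are different, and coincidences between
  their right endpoints only help. So repeats can be counted on incidences alone.\<close>

lemma incidences_bound: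
  assumes I: "finite I" "\<And>x A. (x, A) \<in> I \<Longrightarrow> x \<in> X A"
    and card: "card (fst ` I) \<le> s" "card I \<le> t"
  shows "card I < card (snd ` I) + m"
proof -
  have "\<forall>p\<in>I. \<exists>y. (fst p, y) \<in> edges (snd p)" using I XE by (metis prod.collapse)
  then obtain g where g: "\<And>p. p \<in> I \<Longrightarrow> (fst p, g p) \<in> edges (snd p)" by metis
  define E where "E = (\<lambda>p. (fst p, g p)) ` I"
  have "f (fst p, g p) = snd p" if "p \<in> I" for p using g[OF that] by (auto simp: edges_def)
  then have fE: "f ` E = snd ` I" unfolding E_def image_image by (intro image_cong) auto
  have "inj_on (\<lambda>p. (fst p, g p)) I"
    using g edgesD by (intro inj_onI) (metis prod_eq_iff prod.inject)
  then have "card E = card I" unfolding E_def by (rule card_image)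
  moreover have "fst ` E = fst ` I" unfolding E_def by (simp add: image_image)
  moreover have "card (snd ` E) \<le> t"
    using card_image_le[OF I(1), of g] card unfolding E_def by (simp add: image_image)
  moreover have "E \<subseteq> {..<n} \<times> {..<n}" unfolding E_def using g edgesD by blast
  ultimately show ?thesis using few_repeats[of E] fE card by simp
qed

text \<open>Take \<open>s\<close> incidences with \<open>A\<close> on a set containing
  \<open>U\<close> and add \<open>J\<close>: these are \<open>t\<close> incidences in at most |C| +
  1 colors, so at least t - |C| - 1 repetitions. The last hypothesis on \<open>C\<close> says
  exactly that this is at least \<open>m\<close>.\<close>

lemma incidences_with_common_color:
  assumes A: "s \<le> card (X A)" and U: "U \<subseteq> X A" "card U \<le> s"
    and J: "J \<subseteq> U \<times> C" "\<And>x B. (x, B) \<in> J \<Longrightarrow> x \<in> X B" "card J = t - s"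
    and C: "finite C" "A \<notin> C" "2 * card C + 2 \<le> t - s + 1"
  shows False
proof -
  obtain S where S: "U \<subseteq> S" "S \<subseteq> X A" "card S = s"
    using exists_subset_between[of U s "X A"] A U by auto
  have fin: "finite S" using S(2) by (rule finite_subset) simp
  have finJ: "finite J" using J(1) C(1) S(1) fin by (meson finite_SigmaI finite_subset)
  define I where "I = S \<times> {A} \<union> J"
  have "card I = s + (t - s)"
    unfolding I_def using fin finJ J C S
    by (subst card_Un_disjoint) (auto simp: card_cartesian_product)
  then have cI: "card I = t" using st by simp
  have "fst ` I \<subseteq> S" unfolding I_def using J S by auto
  then have "card (fst ` I) \<le> s" using card_mono[OF fin] S by auto
  moreover have "x \<in> X B" if "(x, B) \<in> I" for x B
    using that J(2) S(2) by (auto simp: I_def)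
  moreover have "finite I" using fin finJ by (simp add: I_def)
  ultimately have "card I < card (snd ` I) + m"
    using incidences_bound[of I] cI by simp
  moreover have "card (snd ` I) \<le> card (insert A C)"
    unfolding I_def using J C by (intro card_mono) auto
  ultimately show False using cI C st m_def by auto
qed

section \<open>Small gap: two colors on a rectangle\<close>

text \<open>For \<open>t = s + 2\<close> the incidence count falls short by one repeat, and a shared vertex supplies
  it: if \<open>x1 y1\<close> is an edge of color \<open>B\<close> inside \<open>X A \<times> Y A\<close>, then putting the \<open>A\<close>-neighbor \<open>z\<close>
  of \<open>y1\<close> on the left side makes \<open>y1\<close> serve both colors.\<close>

lemma two_colors_bound:
  assumes st': "t \<le> s + 4" "s = 3 \<longrightarrow> t = 6" and AB: "A \<noteq> B" and A: "s \<le> card (X A)"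
    and U: "4 \<le> card (fst ` (edges B \<inter> X A \<times> Y A))"
  shows False
proof (cases "t = s + 2")
  case False
  \<comment> \<open>Now t - s is 3 or 4, and a set \<open>W\<close> of this size must fit into the
    part of size \<open>s\<close>; with s = 3 and t = 7 it would not.\<close>
  have "t - s \<le> card (fst ` (edges B \<inter> X A \<times> Y A))" using U st' by linarith
  then obtain W where W: "W \<subseteq> fst ` (edges B \<inter> X A \<times> Y A)" "card W = t - s"
    by (rule obtain_subset_with_card_n)
  then have "W \<subseteq> X A" "W \<subseteq> X B" by force+
  show False
    by (rule incidences_with_common_color[OF A, of W "W \<times> {B}" "{B}"])
      (use \<open>W \<subseteq> X A\<close> \<open>W \<subseteq> X B\<close> W(2) AB False st st' in \<open>auto simp: card_cartesian_product\<close>)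
next
  case True
  \<comment> \<open>The part of size \<open>s\<close> must hold the three vertices of
    \<open>W\<close> and possibly \<open>z\<close> as a fourth; here (3, 5) drops out.\<close>
  then have s: "4 \<le> s" using st st' by auto
  have "3 \<le> card (fst ` (edges B \<inter> X A \<times> Y A))" using U by linarith
  then obtain W where W: "W \<subseteq> fst ` (edges B \<inter> X A \<times> Y A)" "card W = 3"
    by (rule obtain_subset_with_card_n)
  have "\<forall>x\<in>W. \<exists>y. (x, y) \<in> edges B \<and> x \<in> X A \<and> y \<in> Y A" using W(1) by force
  then obtain h where h: "\<And>x. x \<in> W \<Longrightarrow> (x, h x) \<in> edges B \<and> x \<in> X A \<and> h x \<in> Y A" by metis
  have finW: "finite W" using W(2) card.infinite by force
  obtain x1 where x1: "x1 \<in> W" using W by fastforce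
  obtain z where z: "(z, h x1) \<in> edges A" using h[OF x1] by force
  have "card (insert z W) \<le> s" using card_insert_le_m1[of 4 W z] W s by simp
  moreover have "insert z W \<subseteq> X A" using h z by force
  ultimately obtain S where S: "insert z W \<subseteq> S" "S \<subseteq> X A" "card S = s"
    using exists_subset_between[of "insert z W" s "X A"] A by auto
  have finS: "finite S" using S(2) by (rule finite_subset) simp
  have "\<forall>x\<in>S. \<exists>y. (x, y) \<in> edges A" using S XE by (metis subsetD)
  then obtain g0 where g0: "\<And>x. x \<in> S \<Longrightarrow> (x, g0 x) \<in> edges A" by metis
  \<comment> \<open>Redirects the \<open>A\<close>-edge chosen at \<open>z\<close> to
    \<open>h x1\<close>, already the end of the \<open>B\<close>-edge at \<open>x1\<close>.\<close>
  define g where "g = g0(z := h x1)"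
  have g: "(x, g x) \<in> edges A" if "x \<in> S" for x using g0 z that by (simp add: g_def)
  define E where "E = (\<lambda>x. (x, g x)) ` S \<union> (\<lambda>x. (x, h x)) ` W"
  have EA: "(\<lambda>x. (x, g x)) ` S \<subseteq> edges A" "(\<lambda>x. (x, h x)) ` W \<subseteq> edges B" using g h by auto
  have disj: "edges A \<inter> edges B = {}" using AB by (auto simp: edges_def)
  have "card E = card ((\<lambda>x. (x, g x)) ` S) + card ((\<lambda>x. (x, h x)) ` W)"
    unfolding E_def
  proof (rule card_Un_disjoint)
    show "(\<lambda>x. (x, g x)) ` S \<inter> (\<lambda>x. (x, h x)) ` W = {}" using EA disj by blast
  qed (use finS finW in auto)
  also have "\<dots> = s + 3" using S W by (simp add: card_image inj_on_def)
  finally have cE: "card E = s + 3" .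
  have "fst ` E \<subseteq> S" using S unfolding E_def by auto
  then have 1: "card (fst ` E) \<le> s" using card_mono[OF finS] S by auto
  \<comment> \<open>The shared endpoint leaves at most s + 2 = t right endpoints for the s + 3
    edges.\<close>
  have "h x1 \<in> g ` S" using S by (auto simp: g_def image_iff)
  moreover have "snd ` E = g ` S \<union> h ` W" by (simp add: E_def image_Un image_image)
  moreover have "h ` W = insert (h x1) (h ` (W - {x1}))" using x1 by blast
  ultimately have "snd ` E \<subseteq> g ` S \<union> h ` (W - {x1})" by simp
  then have "card (snd ` E) \<le> card (g ` S \<union> h ` (W - {x1}))" using finS finW by (intro card_mono) auto
  also have "\<dots> \<le> card (g ` S) + card (h ` (W - {x1}))" by (rule card_Un_le)
  also have "\<dots> \<le> card S + card (W - {x1})" using finS finW by (intro add_mono card_image_le) auto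
  also have "\<dots> = t" using S W x1 finW True by simp
  finally have 2: "card (snd ` E) \<le> t" .
  have "E \<subseteq> edges A \<union> edges B" using EA by (auto simp: E_def)
  then have 3: "E \<subseteq> {..<n} \<times> {..<n}" "f ` E \<subseteq> {A, B}" by (auto simp: edges_def)
  have "card (f ` E) \<le> 2" using card_mono[OF _ 3(2)] AB by simp
  \<comment> \<open>As t = s + 2, these s + 3 edges in two colors have s + 1 = m
    repetitions.\<close>
  then show False using few_repeats[OF 3(1) 1 2] cE True m_def by simp
qed

text \<open>Cauchy-Schwarz and bounded degrees give n^4 \<le> k t^2 \<Sigma> |X A| |Y A|. If |X A|
  \<ge> s, every other color has at most three left endpoints in the rectangle
  \<open>X A \<times> Y A\<close>, hence at most 3 t of its cells.\<close>

lemma bound_if_small_gap: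
  assumes st': "t \<le> s + 4" "s = 3 \<longrightarrow> t = 6"
  shows "n ^ 4 \<le> s * t\<^sup>2 * k * n\<^sup>2 + 3 * t ^ 3 * k ^ 3"
proof -
  have XY: "card (X A) * card (Y A) \<le> s * card (edges A) + 3 * t * k" if "A < k" for A
  proof (cases "s \<le> card (X A)")
    case False
    \<comment> \<open>A thin rectangle: fewer than \<open>s\<close> left vertices, and |Y A| is at
      most the number of edges of color \<open>A\<close>.\<close>
    have "card (X A) * card (Y A) \<le> s * card (edges A)"
      using False by (intro mult_mono card_image_le) auto
    then show ?thesis by simp
  next
    case True
    have B: "card (edges B \<inter> X A \<times> Y A) \<le> 3 * t" if "B \<noteq> A" for B
    proof -
      have "card (fst ` (edges B \<inter> X A \<times> Y A)) \<le> 3"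
        using two_colors_bound[OF st' that[symmetric] True] by (rule ccontr) auto
      then have "t * card (fst ` (edges B \<inter> X A \<times> Y A)) \<le> t * 3" by (rule mult_le_mono2)
      with card_le_fst[of "edges B \<inter> X A \<times> Y A", OF Int_lower1] show ?thesis by linarith
    qed
    have "X A \<times> Y A \<subseteq> edges A \<union> (\<Union>B\<in>{..<k} - {A}. edges B \<inter> X A \<times> Y A)"
      using colors by (auto simp: edges_def)
    then have "card (X A \<times> Y A) \<le> card (edges A \<union> (\<Union>B\<in>{..<k} - {A}. edges B \<inter> X A \<times> Y A))"
      by (intro card_mono) auto
    also have "\<dots> \<le> card (edges A) + card (\<Union>B\<in>{..<k} - {A}. edges B \<inter> X A \<times> Y A)"
      by (rule card_Un_le)
    also have "card (\<Union>B\<in>{..<k} - {A}. edges B \<inter> X A \<times> Y A)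
        \<le> (\<Sum>B\<in>{..<k} - {A}. card (edges B \<inter> X A \<times> Y A))"
      by (rule card_UN_le) simp
    also have "\<dots> \<le> (\<Sum>B\<in>{..<k} - {A}. 3 * t)" using B by (intro sum_mono) auto
    also have "\<dots> \<le> 3 * t * k" using that by simp
    finally have "card (X A) * card (Y A) \<le> card (edges A) + 3 * t * k"
      by (simp add: card_cartesian_product)
    moreover have "card (edges A) \<le> s * card (edges A)" using st by simp
    ultimately show ?thesis by linarith
  qed
  have "n ^ 4 = (\<Sum>A<k. card (edges A))\<^sup>2" by (simp add: sum_card_edges flip: power_mult)
  also have "\<dots> \<le> k * (\<Sum>A<k. (card (edges A))\<^sup>2)"
    by (rule sum_power2_le)
  also have "(\<Sum>A<k. (card (edges A))\<^sup>2) \<le> (\<Sum>A<k. t\<^sup>2 * (s * card (edges A) + 3 * t * k))"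
  proof (rule sum_mono)
    fix A assume "A \<in> {..<k}"
    then have A: "A < k" by simp
    have "(card (edges A))\<^sup>2 \<le> (t * card (X A)) * (t * card (Y A))"
      unfolding power2_eq_square using card_le_fst[of "edges A" A] card_le_snd[of "edges A" A]
      by (intro mult_mono) auto
    also have "\<dots> = t\<^sup>2 * (card (X A) * card (Y A))" by (simp add: power2_eq_square)
    also have "\<dots> \<le> t\<^sup>2 * (s * card (edges A) + 3 * t * k)" using XY[OF A] by (rule mult_left_mono) simp
    finally show "(card (edges A))\<^sup>2 \<le> t\<^sup>2 * (s * card (edges A) + 3 * t * k)" .
  qed
  also have "\<dots> = t\<^sup>2 * (s * n\<^sup>2 + 3 * t * k * k)"
    by (simp add: sum_card_edges sum.distrib flip: sum_distrib_left)
  finally show ?thesis by (simp add: algebra_simps power2_eq_square power3_eq_cube)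
qed

section \<open>Large gap: colors shared by three vertices\<close>

text \<open>The number \<open>j\<close> is the largest number of colors that
  \<open>incidences_with_common_color\<close> admits, one of them as the common color. The triple
  meets the others in 3 (j - 1) incidences, and this reaches t - s once t - s \<ge> 5; a pair would
  give only 2 (j - 1) < t - s. The bound \<open>t\<close> is a crude form of
  \<open>j\<close>.\<close>

lemma card_colors_on_triple:
  assumes t: "s + 5 \<le> t" and U: "U \<subseteq> {..<n}" "card U = 3"
  shows "card {A \<in> {..<k}. s \<le> card (X A) \<and> U \<subseteq> X A} \<le> t"
proof (rule ccontr)
  define j where "j = (t - s + 1) div 2"
  assume "\<not> ?thesis"
  then have "j \<le> card {A \<in> {..<k}. s \<le> card (X A) \<and> U \<subseteq> X A}"
    using t by (simp add: j_def)
  then obtain D where D: "D \<subseteq> {A \<in> {..<k}. s \<le> card (X A) \<and> U \<subseteq> X A}" "card D = j"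
    by (rule obtain_subset_with_card_n)
  have j: "3 \<le> j" using t by (simp add: j_def)
  then obtain A where A: "A \<in> D" using D by fastforce
  have finD: "finite D" using D(2) j card.infinite by force
  have "t - s \<le> 3 * (j - 1)" using t by (auto simp: j_def)
  then have "t - s \<le> card (U \<times> (D - {A}))"
    using D U A finD by (simp add: card_cartesian_product)
  then obtain J where J: "J \<subseteq> U \<times> (D - {A})" "card J = t - s"
    by (rule obtain_subset_with_card_n)
  have "card (D - {A}) = j - 1" using D A finD by simp
  moreover have "2 * (j - 1) + 2 \<le> t - s + 1" using t by (auto simp: j_def)
  ultimately show False
    using incidences_with_common_color[of A U J "D - {A}"] A D J U finD st by auto
qed

text \<open>Double counting of triples inside the sets \<open>X A\<close>: each triple lies in at
  most \<open>t\<close> of the large ones, so their cubes |X A|^3 sum to O(n^3). Power means and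
  bounded degrees give n^6 \<le> k^2 t^3 \<Sigma> |X A|^3.\<close>

lemma bound_if_large_gap:
  assumes t: "s + 5 \<le> t"
  shows "n ^ 6 \<le> k\<^sup>2 * t ^ 3 * (27 * t * n ^ 3 + k * s ^ 3)"
proof -
  \<comment> \<open>Size at least \<open>s\<close> serves the bound on triples and, as s \<ge> 3,
    also \<open>power3_le_choose\<close>. Colors outside \<open>F\<close> contribute at most k s^3
    in total.\<close>
  define F where "F = {A \<in> {..<k}. s \<le> card (X A)}"
  define P where "P = {U. U \<subseteq> {..<n} \<and> card U = 3}"
  have finP: "finite P" unfolding P_def by (rule finite_subset[of _ "Pow {..<n}"]) auto
  have "X A \<subseteq> {..<n}" for A by (auto simp: edges_def)
  then have "{U \<in> P. U \<subseteq> X A} = {U. U \<subseteq> X A \<and> card U = 3}" for A unfolding P_def by blast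
  then have cP: "card {U \<in> P. U \<subseteq> X A} = card (X A) choose 3" for A by (simp add: n_subsets)
  have "(\<Sum>A\<in>F. card (X A) choose 3) = (\<Sum>U\<in>P. card {A \<in> F. U \<subseteq> X A})"
    unfolding cP[symmetric] by (rule sum_multicount_gen) (use finP in \<open>auto simp: F_def\<close>)
  also have "\<dots> \<le> (\<Sum>U\<in>P. t)"
  proof (rule sum_mono)
    fix U assume "U \<in> P"
    then show "card {A \<in> F. U \<subseteq> X A} \<le> t"
      using card_colors_on_triple[OF t, of U] by (simp add: F_def P_def conj_assoc)
  qed
  also have "\<dots> = (n choose 3) * t" unfolding P_def by (simp add: n_subsets)
  also have "\<dots> \<le> n ^ 3 * t"
    by (cases "3 \<le> n") (auto simp: binomial_le_pow binomial_eq_0)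
  finally have choose: "(\<Sum>A\<in>F. card (X A) choose 3) \<le> n ^ 3 * t" .
  have "n ^ 6 = (\<Sum>A<k. card (edges A)) ^ 3" by (simp add: sum_card_edges flip: power_mult)
  also have "\<dots> \<le> k\<^sup>2 * (\<Sum>A<k. card (edges A) ^ 3)" by (rule sum_power3_le)
  also have "(\<Sum>A<k. card (edges A) ^ 3) \<le> (\<Sum>A<k. t ^ 3 * card (X A) ^ 3)"
    unfolding power_mult_distrib[symmetric] by (intro sum_mono power_mono card_le_fst) auto
  also have "\<dots> = t ^ 3 * (\<Sum>A<k. card (X A) ^ 3)" by (simp add: sum_distrib_left)
  also have "(\<Sum>A<k. card (X A) ^ 3) = (\<Sum>A\<in>F. card (X A) ^ 3) + (\<Sum>A\<in>{..<k} - F. card (X A) ^ 3)"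
    by (subst add.commute, rule sum.subset_diff) (auto simp: F_def)
  also have "(\<Sum>A\<in>F. card (X A) ^ 3) \<le> (\<Sum>A\<in>F. 27 * (card (X A) choose 3))"
    using st by (intro sum_mono power3_le_choose) (auto simp: F_def)
  also have "\<dots> \<le> 27 * (n ^ 3 * t)" using choose by (simp flip: sum_distrib_left)
  also have "(\<Sum>A\<in>{..<k} - F. card (X A) ^ 3) \<le> (\<Sum>A\<in>{..<k} - F. s ^ 3)"
    by (intro sum_mono power_mono) (auto simp: F_def)
  also have "\<dots> \<le> k * s ^ 3"
    using card_mono[of "{..<k}" "{..<k} - F"] by simp
  finally show ?thesis by (simp add: algebra_simps)
qed

section \<open>The lower bound on the number of colors\<close>

text \<open>This is k \<ge> n^(4/3) / C in integer form. For either size of the gap, one of two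
  summands carries half of the left side, and each alternative yields the claim; 54 = 2 * 27
  combines this halving with the constant of \<open>power3_le_choose\<close>.\<close>

lemma colors_bound:
  assumes "(s, t) \<notin> {(3, 5), (3, 7)}"
  shows "n ^ 4 \<le> (54 * s ^ 3 * t ^ 4 * k) ^ 3"
proof (cases "n = 0")
  case False
  define C where "C = 54 * s ^ 3 * t ^ 4"
  have s1: "1 \<le> s" "1 \<le> t" and C1: "1 \<le> C" using st by (auto simp: C_def)
  have C3: "C \<le> C ^ 3" using C1 by (intro self_le_power) auto
  have pow: "n ^ 4 \<le> n ^ 6" using False by (intro power_increasing) auto
  show ?thesis
  proof (cases "t \<le> s + 4")
    case True
    then have "n ^ 4 \<le> s * t\<^sup>2 * k * n\<^sup>2 + 3 * t ^ 3 * k ^ 3"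
      using st assms by (intro bound_if_small_gap) auto
    then consider "n ^ 4 \<le> 2 * (s * t\<^sup>2 * k * n\<^sup>2)" | "n ^ 4 \<le> 2 * (3 * t ^ 3 * k ^ 3)" by linarith
    then show ?thesis
    proof cases
      case 1
      have "n\<^sup>2 * n\<^sup>2 \<le> n\<^sup>2 * (2 * s * t\<^sup>2 * k)"
        using 1 by (simp add: algebra_simps flip: power_add)
      then have n2: "n\<^sup>2 \<le> 2 * s * t\<^sup>2 * k" by (rule mult_left_le_imp_le) (use False in simp)
      have "2 * s * t\<^sup>2 \<le> C"
      proof -
        have "s \<le> s ^ 3" using s1 by (intro self_le_power) auto
        moreover have "t\<^sup>2 \<le> t ^ 4" using s1 by (intro power_increasing) auto
        ultimately have "s * t\<^sup>2 \<le> s ^ 3 * t ^ 4" by (rule mult_le_mono)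
        then show ?thesis unfolding C_def by linarith
      qed
      then have "2 * s * t\<^sup>2 * k \<le> C * k" by (rule mult_le_mono1)
      with n2 have "n\<^sup>2 \<le> C * k" by (rule le_trans)
      then have "(n\<^sup>2) ^ 3 \<le> (C * k) ^ 3" by (rule power_mono) simp
      with pow show ?thesis by (simp add: C_def flip: power_mult)
    next
      case 2
      have "1 \<le> s ^ 3" using s1 by (intro one_le_power)
      moreover have "t ^ 3 \<le> t ^ 4" using s1 by (intro power_increasing) auto
      ultimately have "1 * t ^ 3 \<le> s ^ 3 * t ^ 4" by (rule mult_le_mono)
      then have "6 * t ^ 3 \<le> C" unfolding C_def by linarith
      then have "6 * t ^ 3 * k ^ 3 \<le> C ^ 3 * k ^ 3" using C3 by (intro mult_right_mono) auto
      with 2 show ?thesis unfolding C_def[symmetric] power_mult_distrib by linarith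
    qed
  next
    case False': False
    then have "n ^ 6 \<le> k\<^sup>2 * t ^ 3 * (27 * t * n ^ 3 + k * s ^ 3)" by (intro bound_if_large_gap) auto
    then have "n ^ 6 \<le> 27 * t ^ 4 * k\<^sup>2 * n ^ 3 + s ^ 3 * t ^ 3 * k ^ 3"
      by (simp add: algebra_simps eval_nat_numeral)
    then consider "n ^ 6 \<le> 2 * (27 * t ^ 4 * k\<^sup>2 * n ^ 3)" | "n ^ 6 \<le> 2 * (s ^ 3 * t ^ 3 * k ^ 3)" by linarith
    then show ?thesis
    proof cases
      case 1
      have "n ^ 3 * n ^ 3 \<le> n ^ 3 * (54 * t ^ 4 * k\<^sup>2)"
        using 1 by (simp add: algebra_simps flip: power_add)
      then have n3: "n ^ 3 \<le> 54 * t ^ 4 * k\<^sup>2" by (rule mult_left_le_imp_le) (use False in simp)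
      have "54 * t ^ 4 \<le> C" unfolding C_def using s1 by simp
      moreover have "C \<le> C\<^sup>2" using C1 by (intro self_le_power) auto
      ultimately have "54 * t ^ 4 \<le> C\<^sup>2" by (rule le_trans)
      then have "54 * t ^ 4 * k\<^sup>2 \<le> C\<^sup>2 * k\<^sup>2" by (rule mult_le_mono1)
      with n3 have "n ^ 3 \<le> (C * k)\<^sup>2" unfolding power_mult_distrib by (rule le_trans)
      then have "(n ^ 3) ^ 3 \<le> ((C * k)\<^sup>2) ^ 3" by (rule power_mono) simp
      \<comment> \<open>So far n^9 \<le> (C k)^6; lowering the exponent to 8 makes both sides
        squares, and a root can be taken.\<close>
      moreover have "n ^ 8 \<le> n ^ 9" using False by (intro power_increasing) auto
      ultimately have "(n ^ 4)\<^sup>2 \<le> ((C * k) ^ 3)\<^sup>2" by (simp flip: power_mult)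
      then show ?thesis unfolding power2_nat_le_eq_le C_def .
    next
      case 2
      have "t ^ 3 \<le> t ^ 4" using s1 by (intro power_increasing) auto
      then have "s ^ 3 * t ^ 3 \<le> s ^ 3 * t ^ 4" by (rule mult_le_mono2)
      then have "2 * (s ^ 3 * t ^ 3) \<le> C" unfolding C_def by linarith
      then have "2 * (s ^ 3 * t ^ 3) * k ^ 3 \<le> C ^ 3 * k ^ 3" using C3 by (intro mult_right_mono) auto
      with 2 pow show ?thesis unfolding C_def[symmetric] power_mult_distrib by linarith
    qed
  qed
qed simp

end

section \<open>From colorings to the generalized Ramsey number\<close>

theorem theorem1p2:
  fixes s t :: nat
  assumes "s \<ge> 3" and "t \<ge> s + 2" and "(s, t) \<notin> {(3, 5), (3, 7)}"
  shows "(\<lambda>n. real (gen_ramsey (complete_bipartite n n) (complete_bipartite s t)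
                      (s * t - (s + t) div 2 + 1)))
         \<in> \<Omega>(\<lambda>n. real n powr (4 / 3))"
proof -
  define m where "m = (s + t) div 2"
  define C where "C = 54 * s ^ 3 * t ^ 4"
  define r where "r n = gen_ramsey (complete_bipartite n n) (complete_bipartite s t) (s * t - m + 1)" for n
  have "3 * t \<le> s * t" using assms by (intro mult_right_mono) auto
  then have m: "1 \<le> m" "m \<le> s * t" using assms unfolding m_def by linarith+
  \<comment> \<open>Once n \<ge> t, both parts of K_{s,t} fit into either side of K_{n,n}.\<close>
  have bound: "n ^ 4 \<le> (C * r n) ^ 3" if n: "t \<le> n" for n
  proof -
    \<comment> \<open>As m \<ge> 1, at most s t colors are demanded; so a coloring exists and the
      \<open>LEAST\<close> in \<open>gen_ramsey\<close> is attained.\<close>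
    have ex: "\<exists>k c. c ` uedges (complete_bipartite n n) \<subseteq> {..<k}
        \<and> Hq_coloring (complete_bipartite s t) (s * t - m + 1) (complete_bipartite n n) c"
      using m by (intro Hq_coloring_exists simple_graph_complete_bipartite)
        (simp add: card_edges_complete_bipartite)
    obtain c where c: "c ` uedges (complete_bipartite n n) \<subseteq> {..<r n}"
      "Hq_coloring (complete_bipartite s t) (s * t - m + 1) (complete_bipartite n n) c"
      using LeastI_ex[OF ex] unfolding r_def gen_ramsey_def by blast
    define f where "f = (\<lambda>(x, y). c {Inl x, Inr y})"
    have sn: "s \<le> n" using n assms by simp
    interpret repeat_free f n "r n" s t m
    proof
      fix x y assume "x < n" "y < n"
      then show "f (x, y) < r n" using c(1) by (auto simp: f_def complete_bipartite_def)
    next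
      fix E :: "(nat \<times> nat) set"
      assume E: "E \<subseteq> {..<n} \<times> {..<n}" "card (fst ` E) \<le> s" "card (snd ` E) \<le> t"
      show "card E < card (f ` E) + m"
        unfolding f_def
        by (rule card_edges_less_colors[OF c(2) _ _ _ _ m(2) sn n E, where a' = id])
          (auto simp: complete_bipartite_def)
    next
      fix E :: "(nat \<times> nat) set"
      assume E: "E \<subseteq> {..<n} \<times> {..<n}" "card (fst ` E) \<le> t" "card (snd ` E) \<le> s"
      \<comment> \<open>With the part of size \<open>s\<close> on the right, \<open>a\<close>
        becomes \<open>Inr\<close>, \<open>b\<close> becomes \<open>Inl\<close>, and the pairs in
        \<open>E\<close> are swapped.\<close>
      have "card (prod.swap ` E) < card ((\<lambda>(x, y). c {Inr x, Inl y}) ` prod.swap ` E) + m"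
        by (rule card_edges_less_colors[OF c(2) _ _ _ _ m(2) sn n, where a' = "case_sum Inr Inl"])
          (use E in \<open>auto simp: complete_bipartite_def image_image insert_commute\<close>)
      moreover have "(\<lambda>(x, y). c {Inr x, Inl y}) ` prod.swap ` E = f ` E"
        unfolding f_def image_image by (auto simp: insert_commute intro!: image_cong)
      ultimately show "card E < card (f ` E) + m" by (simp add: card_image)
    qed (use assms m_def in auto)
    show ?thesis using colors_bound assms(3) unfolding C_def by simp
  qed
  have C: "0 < C" using assms by (simp add: C_def)
  have "1 / C * norm (real n powr (4 / 3)) \<le> norm (real (r n))" if n: "t \<le> n" for n
  proof -
    have "(real n powr (4 / 3)) ^ 3 = real n powr 4" using n assms by (subst powr_power) auto
    also have "\<dots> = real (n ^ 4)" using n assms by simp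
    also have "\<dots> \<le> real ((C * r n) ^ 3)" using bound[OF n] by (simp only: of_nat_le_iff)
    finally have "(real n powr (4 / 3)) ^ 3 \<le> (real C * real (r n)) ^ 3" by simp
    then have "real n powr (4 / 3) \<le> real C * real (r n)" by (subst (asm) power_mono_iff) auto
    then show ?thesis using C by (simp add: field_simps)
  qed
  then have "r \<in> \<Omega>(\<lambda>n. real n powr (4 / 3))"
    using C by (intro landau_omega.bigI[of "1 / C"]) (auto simp: eventually_at_top_linorder)
  then show ?thesis by (simp add: r_def m_def)
qed

end
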